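(* Let $g$ be a smooth vector field on $\mathbb{R}^n$ and $\omega$ a smooth 1-form on $\mathbb{R}^n$ with $\omega(g)\neq0$ everywhere and $d\omega\wedge\omega=0$. Let $\mathcal{O}=\{x\in\mathbb{R}^n:\psi(x)=0\}$ be an integral manifold of $\omega$, where $\psi:\mathbb{R}^n\to\mathbb{R}$ is smooth with $d\psi=\mu\,\omega$ for a nowhere vanishing function $\mu$, and let $\pi:\mathbb{R}^n\to\mathcal{O}$ be the smooth projection along integral curves of $g$. Then the Lie algebroid with anchor $\mathrm{an}_\pi$ and the Lie algebroid with anchor $\mathrm{an}_{\omega,g}$ are isomorphic in the following sense: there is a one-to-one correspondence between the $\mathcal{O}$-projectable vector fields $\tilde m$ on $\mathbb{R}^n$ and the corresponding line bundles in the $(g,\omega)$-quotient bundle, i.e. the map $$\tilde m\longmapsto \{\tilde m+\alpha g:\ \alpha\in C^\infty(\mathbb{R}^n)\}$$ is a bijection from the set of $\mathcal{O}$-projectable vector fields onto the set of classes $\{m+\alpha g:\alpha\in C^\infty(\mathbb{R}^n)\}$ of smooth vector fields $m$ on $\mathbb{R}^n$ that project under $\pi$ to a vector field on $\mathcal{O}$.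
   Context: Standing assumption: every maximal integral curve of $g$ meets $\mathcal{O}$ in exactly one point; $\pi(x)$ is the point where the integral curve of $g$ through $x$ meets $\mathcal{O}$. In particular $d\pi(g)=0$. A vector field $m$ on $\mathbb{R}^n$ projects under $\pi$ to a vector field $\bar m$ on $\mathcal{O}$ if $d\pi_x(m(x))=\bar m(\pi(x))$ for all $x\in\mathbb{R}^n$; this depends only on the class of $m$ modulo multiples of $g$. An $\mathcal{O}$-projectable vector field is a smooth vector field $\tilde m$ on $\mathbb{R}^n$ that projects under $\pi$ to a vector field on $\mathcal{O}$ and is tangent to the leaves of the foliation of $\omega$, i.e. $\omega(\tilde m)=0$ (equivalently, in coordinates $z=(\gamma_1,\dots,\gamma_{n-1},\psi)$ with $d\gamma_i(g)=0$ and the $d\gamma_i$ independent, $\tilde m$ has the form $(\bar m,0)$ with $\bar m$ depending only on $z_1,\dots,z_{n-1}$). The two algebroids both use the bracket $\langle m_1,m_2\rangle=[m_1,m_2]+\frac{\omega(m_2)}{\omega(g)}[g,m_1]-\frac{\omega(m_1)}{\omega(g)}[g,m_2]$ on classes of vector fields modulo multiples of $g$. The first has base $\mathcal{O}$ and anchor $\mathrm{an}_\pi(m)=\pi_*m$; the second has anchor $\mathrm{an}_{\omega,g}(m)=m-\frac{\omega(m)}{\omega(g)}g$. *)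

theory Defs
  imports "HOL-Analysis.Analysis"
begin

text \<open>
  Differentiability classes are meant for open sets only. The clause for \<open>Suc k\<close> asks for all
  directional derivatives to be of class \<open>C\<^sup>k\<close>, which in finite dimension is the same as asking it of
  the total derivative.
\<close>

primrec Ck_on :: "nat \<Rightarrow> 'a::real_normed_vector set \<Rightarrow> ('a \<Rightarrow> 'b::real_normed_vector) \<Rightarrow> bool" where
  "Ck_on 0 S f \<longleftrightarrow> continuous_on S f"
| "Ck_on (Suc k) S f \<longleftrightarrow>
     (\<forall>x\<in>S. f differentiable (at x)) \<and> (\<forall>v. Ck_on k S (\<lambda>x. frechet_derivative f (at x) v))"

definition smooth_on :: "'a::real_normed_vector set \<Rightarrow> ('a \<Rightarrow> 'b::real_normed_vector) \<Rightarrow> bool" where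
  "smooth_on S f \<longleftrightarrow> (\<forall>k. Ck_on k S f)"

abbreviation smooth :: "('a::real_normed_vector \<Rightarrow> 'b::real_normed_vector) \<Rightarrow> bool" where
  "smooth \<equiv> smooth_on UNIV"

text \<open>
  A 1-form assigns to each point a bounded linear functional; in finite dimension these are all
  linear functionals, and smoothness refers to the normed space of functionals. The exterior
  derivative and the wedge product below are normalised without factorials, which does not affect
  whether \<open>d\<omega> \<and> \<omega>\<close> vanishes.
\<close>

type_synonym 'a vfield = "'a \<Rightarrow> 'a"
type_synonym 'a one_form = "'a \<Rightarrow> ('a \<Rightarrow>\<^sub>L real)"

definition ext_deriv :: "'a::real_normed_vector one_form \<Rightarrow> 'a \<Rightarrow> 'a \<Rightarrow> 'a \<Rightarrow> real" where
  "ext_deriv \<omega> x u v =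
     blinfun_apply (frechet_derivative \<omega> (at x) u) v - blinfun_apply (frechet_derivative \<omega> (at x) v) u"

definition wedge21 ::
  "('a \<Rightarrow> 'a \<Rightarrow> 'a \<Rightarrow> real) \<Rightarrow> 'a::real_normed_vector one_form \<Rightarrow> 'a \<Rightarrow> 'a \<Rightarrow> 'a \<Rightarrow> 'a \<Rightarrow> real" where
  "wedge21 \<beta> \<omega> x u v w =
     \<beta> x u v * blinfun_apply (\<omega> x) w + \<beta> x v w * blinfun_apply (\<omega> x) u
       + \<beta> x w u * blinfun_apply (\<omega> x) v"

text \<open>
  Integral curves live on nonempty open intervals; the values of \<open>\<gamma>\<close> outside \<open>I\<close> are irrelevant.
\<close>

definition integral_curve :: "'a::real_normed_vector vfield \<Rightarrow> real set \<Rightarrow> (real \<Rightarrow> 'a) \<Rightarrow> bool" where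
  "integral_curve g I \<gamma> \<longleftrightarrow>
     open I \<and> is_interval I \<and> I \<noteq> {} \<and> (\<forall>t\<in>I. (\<gamma> has_vector_derivative g (\<gamma> t)) (at t))"

definition maximal_integral_curve ::
  "'a::real_normed_vector vfield \<Rightarrow> real set \<Rightarrow> (real \<Rightarrow> 'a) \<Rightarrow> bool" where
  "maximal_integral_curve g I \<gamma> \<longleftrightarrow>
     integral_curve g I \<gamma> \<and>
     (\<forall>J \<delta>. integral_curve g J \<delta> \<and> I \<subseteq> J \<and> (\<forall>t\<in>I. \<delta> t = \<gamma> t) \<longrightarrow> J = I)"

text \<open>
  Tangent vectors of an embedded submanifold are velocities of smooth curves inside it. A map
  defined on a subset is smooth if it locally extends to a smooth map on an open set. A vector field
  on \<open>S\<close> is a total function whose values outside \<open>S\<close> are irrelevant.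
\<close>

definition tangent_vector :: "'a::real_normed_vector set \<Rightarrow> 'a \<Rightarrow> 'a \<Rightarrow> bool" where
  "tangent_vector S p v \<longleftrightarrow>
     (\<exists>\<epsilon>>0. \<exists>\<gamma>::real \<Rightarrow> 'a. smooth_on {-\<epsilon><..<\<epsilon>} \<gamma> \<and> \<gamma> ` {-\<epsilon><..<\<epsilon>} \<subseteq> S \<and> \<gamma> 0 = p \<and>
        (\<gamma> has_vector_derivative v) (at 0))"

definition vector_field_on :: "'a::real_normed_vector set \<Rightarrow> 'a vfield \<Rightarrow> bool" where
  "vector_field_on S m \<longleftrightarrow>
     (\<forall>p\<in>S. tangent_vector S p (m p)) \<and>
     (\<forall>p\<in>S. \<exists>U F. open U \<and> p \<in> U \<and> smooth_on U F \<and> (\<forall>q\<in>U \<inter> S. F q = m q))"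

definition projects_to_vector_field ::
  "'a::real_normed_vector set \<Rightarrow> ('a \<Rightarrow> 'a) \<Rightarrow> 'a vfield \<Rightarrow> bool" where
  "projects_to_vector_field S \<pi> m \<longleftrightarrow>
     (\<exists>mbar. vector_field_on S mbar \<and> (\<forall>x. frechet_derivative \<pi> (at x) (m x) = mbar (\<pi> x)))"

definition projectable_vector_field ::
  "'a::real_normed_vector one_form \<Rightarrow> 'a set \<Rightarrow> ('a \<Rightarrow> 'a) \<Rightarrow> 'a vfield \<Rightarrow> bool" where
  "projectable_vector_field \<omega> S \<pi> m \<longleftrightarrow>
     smooth m \<and> projects_to_vector_field S \<pi> m \<and> (\<forall>x. blinfun_apply (\<omega> x) (m x) = 0)"

definition class_mod :: "'a::real_normed_vector vfield \<Rightarrow> 'a vfield \<Rightarrow> 'a vfield set" where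
  "class_mod g m = {(\<lambda>x. m x + \<alpha> x *\<^sub>R g x) | \<alpha>. smooth \<alpha>}"

end

theory Submission
  imports Defs
begin

text \<open>
  Contracting a field with \<open>\<omega>\<close> shows that a class modulo \<open>g\<close> contains at most one field in the
  kernel of \<open>\<omega>\<close>, and \<open>m - (\<omega>(m)/\<omega>(g)) g\<close> is such a field. It still projects under \<open>\<pi>\<close> because
  \<open>d\<pi>(g) = 0\<close>: through every point passes a maximal integral curve (Picard's theorem and Zorn's
  lemma), and \<open>\<pi>\<close> is constant along it, as the curve meets \<open>\<O>\<close> only once.
\<close>

subsection \<open>Closure properties of smooth maps\<close>

text \<open>A Frechet derivative depends only on the values near the point, so on an open set
  agreement passes to all directional derivatives, and the induction goes through for arbitrary
  \<open>f\<close> and \<open>g\<close>.\<close>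

lemma Ck_on_cong:
  assumes "open S" "\<And>x. x \<in> S \<Longrightarrow> f x = g x" "Ck_on k S f"
  shows "Ck_on k S g"
  using assms(2,3)
proof (induction k arbitrary: f g)
  case 0
  then show ?case
    using continuous_on_cong[of S S f g] by simp
next
  case (Suc k)
  have diff: "f differentiable (at x)" if "x \<in> S" for x
    using Suc.prems(2) that by simp
  have "g differentiable (at x)" if "x \<in> S" for x
    using diff[OF that] has_derivative_transform_within_open[OF _ assms(1) that] Suc.prems(1)
    unfolding differentiable_def by blast
  moreover have "Ck_on k S (\<lambda>x. frechet_derivative g (at x) v)" for v
  proof (rule Suc.IH)
    show "frechet_derivative f (at x) v = frechet_derivative g (at x) v" if "x \<in> S" for x
      using frechet_derivative_transform_within_open[OF diff[OF that] assms(1) that Suc.prems(1)]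
      by simp
    show "Ck_on k S (\<lambda>x. frechet_derivative f (at x) v)"
      using Suc.prems(2) by simp
  qed
  ultimately show ?case by simp
qed

text \<open>This lets the later inductions work with an explicit derivative formula in place of the
  derivative chosen by \<open>frechet_derivative\<close>; the two coincide by uniqueness of
  derivatives.\<close>

lemma Ck_on_SucI:
  assumes "open S" "\<And>x. x \<in> S \<Longrightarrow> (f has_derivative f' x) (at x)" "\<And>v. Ck_on k S (\<lambda>x. f' x v)"
  shows "Ck_on (Suc k) S f"
proof -
  have "Ck_on k S (\<lambda>x. frechet_derivative f (at x) v)" for v
    by (rule Ck_on_cong[OF assms(1) _ assms(3)]) (simp add: frechet_derivative_at[OF assms(2)])
  then show ?thesis
    using assms(2) by (auto simp: differentiable_def)
qed

lemma Ck_on_Suc_has_derivative: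
  assumes "Ck_on (Suc k) S f" "x \<in> S"
  shows "(f has_derivative frechet_derivative f (at x)) (at x)"
  using assms frechet_derivative_works by auto

lemma Ck_on_SucD: "Ck_on (Suc k) S f \<Longrightarrow> Ck_on k S f"
proof (induction k arbitrary: f)
  case 0
  then show ?case
    by (auto intro!: continuous_at_imp_continuous_on differentiable_imp_continuous_within)
next
  case (Suc k)
  then show ?case by simp
qed

lemma Ck_on_const: "Ck_on k S (\<lambda>x. c)"
  by (induction k arbitrary: c) simp_all

lemma Ck_on_add:
  assumes "open S"
  shows "Ck_on k S f \<Longrightarrow> Ck_on k S g \<Longrightarrow> Ck_on k S (\<lambda>x. f x + g x)"
proof (induction k arbitrary: f g)
  case 0
  then show ?case by (auto intro: continuous_on_add)
next
  case (Suc k)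
  show ?case
  proof (rule Ck_on_SucI[OF assms])
    show "((\<lambda>x. f x + g x) has_derivative
        (\<lambda>v. frechet_derivative f (at x) v + frechet_derivative g (at x) v)) (at x)" if "x \<in> S" for x
      using Suc.prems that by (intro has_derivative_add Ck_on_Suc_has_derivative) auto
    show "Ck_on k S (\<lambda>x. frechet_derivative f (at x) v + frechet_derivative g (at x) v)" for v
      using Suc.prems by (intro Suc.IH) auto
  qed
qed

text \<open>One Leibniz argument covers real products, scaling of vector fields and evaluation of a
  1-form on a field. The product rule also contains the undifferentiated factors, so these are first
  lowered to level \<open>k\<close> by \<open>Ck_on_SucD\<close>.\<close>

lemma Ck_on_bilinear:
  assumes "open S" "bounded_bilinear B"
  shows "Ck_on k S f \<Longrightarrow> Ck_on k S g \<Longrightarrow> Ck_on k S (\<lambda>x. B (f x) (g x))"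
proof (induction k arbitrary: f g)
  case 0
  then show ?case
    by (auto intro: bounded_bilinear.continuous_on[OF assms(2)])
next
  case (Suc k)
  note fg = Ck_on_SucD[OF Suc.prems(1)] Ck_on_SucD[OF Suc.prems(2)]
  show ?case
  proof (rule Ck_on_SucI[OF assms(1)])
    show "((\<lambda>x. B (f x) (g x)) has_derivative
        (\<lambda>v. B (f x) (frechet_derivative g (at x) v) + B (frechet_derivative f (at x) v) (g x))) (at x)"
      if "x \<in> S" for x
      using Suc.prems that
      by (intro bounded_bilinear.FDERIV[OF assms(2)] Ck_on_Suc_has_derivative) auto
    show "Ck_on k S (\<lambda>x. B (f x) (frechet_derivative g (at x) v)
        + B (frechet_derivative f (at x) v) (g x))" for v
      using Suc.prems fg by (intro Ck_on_add[OF assms(1)] Suc.IH) auto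
  qed
qed

lemma Ck_on_inverse:
  fixes f :: "'a::real_normed_vector \<Rightarrow> 'b::real_normed_div_algebra"
  assumes "open S" "\<And>x. x \<in> S \<Longrightarrow> f x \<noteq> 0"
  shows "Ck_on k S f \<Longrightarrow> Ck_on k S (\<lambda>x. inverse (f x))"
proof (induction k)
  case 0
  then show ?case using assms(2) by (auto intro: continuous_on_inverse)
next
  case (Suc k)
  \<comment> \<open>The derivative of the inverse contains the inverse itself, which the induction
    hypothesis supplies at level \<open>k\<close>.\<close>
  note inv = Suc.IH[OF Ck_on_SucD[OF Suc.prems]]
  show ?case
  proof (rule Ck_on_SucI[OF assms(1)])
    show "((\<lambda>x. inverse (f x)) has_derivative
        (\<lambda>v. - (inverse (f x) * frechet_derivative f (at x) v * inverse (f x)))) (at x)"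
      if "x \<in> S" for x
      using Suc.prems that assms(2) by (intro Deriv.has_derivative_inverse Ck_on_Suc_has_derivative) auto
    \<comment> \<open>Negation is written as multiplication by the constant -1, so that closure
      under bilinear maps covers it.\<close>
    have "Ck_on k S (\<lambda>x. (-1) * (inverse (f x) * frechet_derivative f (at x) v * inverse (f x)))" for v
      using Suc.prems inv
      by (intro Ck_on_bilinear[OF assms(1) bounded_bilinear_mult] Ck_on_const) auto
    then show "Ck_on k S (\<lambda>x. - (inverse (f x) * frechet_derivative f (at x) v * inverse (f x)))" for v
      by simp
  qed
qed

lemma smooth_on_const: "smooth_on S (\<lambda>x. c)"
  by (simp add: smooth_on_def Ck_on_const)

lemma smooth_on_add:
  "open S \<Longrightarrow> smooth_on S f \<Longrightarrow> smooth_on S g \<Longrightarrow> smooth_on S (\<lambda>x. f x + g x)"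
  by (simp add: smooth_on_def Ck_on_add)

lemma smooth_on_bilinear:
  "open S \<Longrightarrow> bounded_bilinear B \<Longrightarrow> smooth_on S f \<Longrightarrow> smooth_on S g
    \<Longrightarrow> smooth_on S (\<lambda>x. B (f x) (g x))"
  by (simp add: smooth_on_def Ck_on_bilinear)

lemma smooth_on_inverse:
  fixes f :: "'a::real_normed_vector \<Rightarrow> 'b::real_normed_div_algebra"
  shows "open S \<Longrightarrow> (\<And>x. x \<in> S \<Longrightarrow> f x \<noteq> 0) \<Longrightarrow> smooth_on S f \<Longrightarrow> smooth_on S (\<lambda>x. inverse (f x))"
  by (simp add: smooth_on_def Ck_on_inverse)

lemma smooth_on_has_derivative:
  assumes "smooth_on S f" "x \<in> S"
  shows "(f has_derivative frechet_derivative f (at x)) (at x)"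
  using assms Ck_on_Suc_has_derivative unfolding smooth_on_def by blast

subsection \<open>Existence of maximal integral curves\<close>

text \<open>The derivatives along the basis vectors are continuous, hence bounded on the compact
  set, and the sum of their norms dominates the operator norm. Convexity then allows the mean value
  inequality.\<close>

lemma smooth_lipschitz_on_compact_convex:
  fixes f :: "'a::euclidean_space \<Rightarrow> 'b::real_normed_vector"
  assumes "smooth_on S f" "compact K" "convex K" "K \<subseteq> S"
  obtains L where "L-lipschitz_on K f"
proof -
  let ?D = "\<lambda>x. frechet_derivative f (at x)"
  have "Ck_on (Suc 0) S f"
    using assms(1) unfolding smooth_on_def by blast
  then have "continuous_on K (\<lambda>x. \<Sum>i\<in>Basis. norm (?D x i))"
    using assms(4) by (intro continuous_intros) (auto intro: continuous_on_subset)
  then have "bounded ((\<lambda>x. \<Sum>i\<in>Basis. norm (?D x i)) ` K)"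
    using assms(2) compact_continuous_image compact_imp_bounded by blast
  then obtain L where L: "L > 0" "\<And>x. x \<in> K \<Longrightarrow> norm (\<Sum>i\<in>Basis. norm (?D x i)) \<le> L"
    unfolding bounded_pos by auto
  have der: "(f has_derivative ?D x) (at x)" if "x \<in> K" for x
    using smooth_on_has_derivative assms(1,4) that by blast
  have "onorm (?D x) \<le> L" if "x \<in> K" for x
    using onorm_componentwise[OF has_derivative_bounded_linear[OF der[OF that]]] L(2)[OF that]
    by (simp add: sum_nonneg)
  then have "norm (f x - f y) \<le> L * norm (x - y)" if "x \<in> K" "y \<in> K" for x y
    using differentiable_bound[OF assms(3) has_derivative_at_withinI[OF der]] that by blast
  then have "L-lipschitz_on K f"
    using L(1) by (auto simp: lipschitz_on_def dist_norm)
  then show ?thesis by (rule that)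
qed

text \<open>The solution is the fixed point of the Picard operator on the Banach space of bounded
  continuous functions on the line. As the Lipschitz bound is global, candidate solutions need not
  be confined to a ball.\<close>

lemma picard_lipschitz:
  fixes h :: "'a::banach \<Rightarrow> 'a"
  assumes "L-lipschitz_on UNIV h"
  obtains d u where "d > 0" "u 0 = x"
    "\<And>t. t \<in> {-d<..<d} \<Longrightarrow> (u has_vector_derivative h (u t)) (at t)"
proof -
  \<comment> \<open>This choice gives \<open>L * d \<le> 1/2\<close>, the contraction factor; adding
    1 keeps the denominator positive when \<open>L = 0\<close>.\<close>
  define d where "d = 1 / (2 * (L + 1))"
  have L: "L \<ge> 0" "\<And>a b. norm (h a - h b) \<le> L * norm (a - b)"
    using assms by (auto simp: lipschitz_on_def dist_norm)
  have d: "d > 0" "L * d \<le> 1 / 2"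
    using L(1) by (auto simp: d_def field_simps)
  have "continuous_on UNIV h"
    using assms by (rule lipschitz_on_continuous_on)
  then have cont: "continuous_on {-d..d} (\<lambda>s. h (apply_bcontfun u s))" for u :: "real \<Rightarrow>\<^sub>C 'a"
    by (rule continuous_on_compose2) auto
  \<comment> \<open>Both integrals start at \<open>-d\<close>, so that one formula serves positive
    and negative times; subtracting the integral up to 0 normalises the value at 0 to
    \<open>x\<close>.\<close>
  define P where "P u t = x + (integral {-d..t} (\<lambda>s. h (apply_bcontfun u s))
      - integral {-d..0} (\<lambda>s. h (apply_bcontfun u s)))" for u :: "real \<Rightarrow>\<^sub>C 'a" and t
  have P0: "P u 0 = x" for u
    by (simp add: P_def)
  have P': "(P u has_vector_derivative h (apply_bcontfun u t)) (at t within {-d..d})"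
    if "t \<in> {-d..d}" for u t
    unfolding P_def
    by (auto intro!: derivative_eq_intros integral_has_vector_derivative[OF cont that])
  have "continuous_on {-d..d} (P u)" for u
    using P' has_vector_derivative_continuous unfolding continuous_on_eq_continuous_within by blast
  \<comment> \<open>Clamping freezes \<open>P u\<close> at its endpoint values outside
    \<open>{-d..d}\<close>, which makes it a bounded continuous function on the whole line.\<close>
  then have "\<exists>v :: real \<Rightarrow>\<^sub>C 'a. \<forall>t. apply_bcontfun v t = P u (clamp (-d) d t)" for u
    by (metis continuous_on_cbox_bcontfunE interval_cbox)
  then obtain T :: "(real \<Rightarrow>\<^sub>C 'a) \<Rightarrow> (real \<Rightarrow>\<^sub>C 'a)"
    where T: "\<And>u t. apply_bcontfun (T u) t = P u (clamp (-d) d t)"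
    by metis
  have "dist (T u) (T v) \<le> 1/2 * dist u v" for u v
  proof (rule dist_bound)
    fix t
    define s where "s = clamp (-d) d t"
    have s: "s \<in> {-d..d}"
      using clamp_in_interval[of "-d" d t] d(1) by (simp add: s_def)
    \<comment> \<open>\<open>P u\<close> and \<open>P v\<close> agree at 0, so the mean value
      inequality between 0 and \<open>s\<close> bounds their difference by a bound for its
      derivative times the length of the interval.\<close>
    have "norm ((P u s - P v s) - (P u 0 - P v 0)) \<le> (L * dist u v) * norm (s - 0)"
    proof (rule differentiable_bound[of "{-d..d}"])
      show "((\<lambda>s. P u s - P v s) has_derivative
          (\<lambda>r. r *\<^sub>R (h (apply_bcontfun u r') - h (apply_bcontfun v r')))) (at r' within {-d..d})"
        if "r' \<in> {-d..d}" for r'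
        using has_vector_derivative_diff[OF P'[OF that] P'[OF that]]
        unfolding has_vector_derivative_def .
      show "onorm (\<lambda>r. r *\<^sub>R (h (apply_bcontfun u r') - h (apply_bcontfun v r'))) \<le> L * dist u v"
        for r'
      proof (rule onorm_bound)
        show "0 \<le> L * dist u v" using L(1) by simp
        have "norm (h (apply_bcontfun u r') - h (apply_bcontfun v r')) \<le> L * dist u v"
          by (rule order_trans[OF L(2)])
             (use L(1) in \<open>auto intro!: mult_left_mono simp: dist_bounded simp flip: dist_norm\<close>)
        then show "norm (r *\<^sub>R (h (apply_bcontfun u r') - h (apply_bcontfun v r')))
            \<le> L * dist u v * norm r" for r
          by (simp add: mult.commute mult_left_mono)
      qed
    qed (use s d in auto)
    also have "\<dots> \<le> (L * dist u v) * d"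
      using s L(1) by (intro mult_left_mono) auto
    also have "\<dots> = (L * d) * dist u v" by simp
    also have "\<dots> \<le> 1/2 * dist u v"
      using d(2) by (rule mult_right_mono) simp
    finally show "dist (apply_bcontfun (T u) t) (apply_bcontfun (T v) t) \<le> 1/2 * dist u v"
      by (simp add: T P0 dist_norm s_def)
  qed
  then obtain u where "T u = u"
    using banach_fix_type[of "1/2" T] by auto
  \<comment> \<open>On \<open>{-d..d}\<close> the clamp is the identity, so there the fixed point
    satisfies the integral equation itself.\<close>
  then have u: "apply_bcontfun u t = P u t" if "t \<in> {-d..d}" for t
    using T[of u t] that clamp_cancel_cbox[of t "-d" d] by simp
  show ?thesis
  proof (rule that[OF d(1), of "apply_bcontfun u"])
    show "apply_bcontfun u 0 = x"
      using u d(1) by (simp add: P0)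
    fix t assume t: "t \<in> {-d<..<d}"
    then have "(P u has_vector_derivative h (apply_bcontfun u t)) (at t)"
      using P'[of t u] at_within_Icc_at[of "-d" t d] by auto
    then show "(apply_bcontfun u has_vector_derivative h (apply_bcontfun u t)) (at t)"
      by (rule has_vector_derivative_transform_within_open[of _ _ _ "{-d<..<d}"]) (use t u in auto)
  qed
qed

lemma smooth_integral_curve_exists:
  fixes g :: "'a::euclidean_space vfield"
  assumes "smooth g"
  obtains I \<gamma> where "integral_curve g I \<gamma>" "0 \<in> I" "\<gamma> 0 = x"
proof -
  let ?c = "closest_point (cball x 1)"
  obtain L where L: "L-lipschitz_on (cball x 1) g"
    using smooth_lipschitz_on_compact_convex[OF assms compact_cball convex_cball] by blast
  \<comment> \<open>Precomposing with the nearest-point retraction makes the field globally Lipschitz.\<close>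
  have "1-lipschitz_on UNIV ?c"
    by (auto simp: lipschitz_on_def closest_point_lipschitz)
  moreover have "L-lipschitz_on (range ?c) g"
    using closest_point_in_set[of "cball x 1"] by (intro lipschitz_on_subset[OF L]) auto
  ultimately have "(L * 1)-lipschitz_on UNIV (\<lambda>y. g (?c y))"
    by (rule lipschitz_on_compose2)
  then obtain d u where d: "d > 0" "u 0 = x"
    and u: "\<And>t. t \<in> {-d<..<d} \<Longrightarrow> (u has_vector_derivative g (?c (u t))) (at t)"
    by (rule picard_lipschitz[where x = x]) blast
  \<comment> \<open>By continuity the solution stays in the unit ball around \<open>x\<close> for a
    short time \<open>e\<close>. The retraction is the identity there, so up to time
    \<open>min d e\<close> the curve solves the equation of \<open>g\<close> itself.\<close>
  have "isCont u 0"
    using u[of 0] d(1) has_vector_derivative_continuous by fastforce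
  then obtain e where e: "e > 0" "\<And>t. dist t 0 < e \<Longrightarrow> dist (u t) (u 0) < 1"
    unfolding continuous_at_eps_delta by (metis dist_norm zero_less_one real_norm_def)
  show ?thesis
  proof (rule that)
    show "integral_curve g {-min d e<..<min d e} u"
      unfolding integral_curve_def
    proof (intro conjI ballI)
      fix t assume t: "t \<in> {-min d e<..<min d e}"
      then have "\<bar>t\<bar> < d" "\<bar>t\<bar> < e"
        by (auto simp: abs_less_iff)
      then have "u t \<in> cball x 1" "t \<in> {-d<..<d}"
        using e(2)[of t] d(2) by (auto simp: dist_commute)
      then show "(u has_vector_derivative g (u t)) (at t)"
        using u[of t] by (simp add: closest_point_self)
    qed (use d e in \<open>auto simp: is_interval_oo\<close>)
  qed (use d e in auto)
qed

text \<open>Zorn's lemma is applied to the graphs of all extensions of the given curve, ordered by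
  inclusion. Graphs rather than pairs of interval and function are used because values outside the
  interval must not distinguish two extensions.\<close>

lemma integral_curve_extends_maximal:
  assumes "integral_curve g I \<gamma>"
  obtains J \<delta> where "maximal_integral_curve g J \<delta>" "I \<subseteq> J" "\<And>t. t \<in> I \<Longrightarrow> \<delta> t = \<gamma> t"
proof -
  define ext where
    "ext J \<delta> \<longleftrightarrow> integral_curve g J \<delta> \<and> I \<subseteq> J \<and> (\<forall>t\<in>I. \<delta> t = \<gamma> t)" for J \<delta>
  define graph where "graph J \<delta> = (\<lambda>t. (t, \<delta> t)) ` J" for J :: "real set" and \<delta> :: "real \<Rightarrow> 'a"
  have fst_graph: "fst ` graph J \<delta> = J" for J \<delta>
    by (simp add: graph_def image_image)
  define A where "A = {graph J \<delta> |J \<delta>. ext J \<delta>}"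
  obtain t0 where t0: "t0 \<in> I"
    using assms by (auto simp: integral_curve_def)
  have "\<exists>M\<in>A. \<forall>X\<in>A. M \<subseteq> X \<longrightarrow> X = M"
  proof (rule subset_Zorn_nonempty)
    have "ext I \<gamma>"
      using assms by (simp add: ext_def)
    then show "A \<noteq> {}"
      unfolding A_def by blast
    fix C assume C: "C \<noteq> {}" "subset.chain A C"
    define J where "J = fst ` \<Union>C"
    define \<delta> where "\<delta> t = (THE y. (t, y) \<in> \<Union>C)" for t
    have member: "\<exists>K \<epsilon>. X = graph K \<epsilon> \<and> ext K \<epsilon>" if "X \<in> C" for X
      using C(2) that unfolding subset_chain_def A_def by blast
    \<comment> \<open>The union of the chain is single-valued: two of its members are comparable, so
      both points lie in the larger one, which is a graph. Hence the description defining
      \<open>\<delta>\<close> picks a unique value.\<close>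
    have "y = z" if yz: "(t, y) \<in> \<Union>C" "(t, z) \<in> \<Union>C" for t y z
    proof -
      obtain Y Z where YZ: "Y \<in> C" "(t, y) \<in> Y" "Z \<in> C" "(t, z) \<in> Z"
        using yz by blast
      then have "Y \<subseteq> Z \<or> Z \<subseteq> Y"
        using C(2) by (simp add: subset_chain_def)
      then obtain X where "X \<in> C" "(t, y) \<in> X" "(t, z) \<in> X"
        using YZ by blast
      then show ?thesis
        using member[of X] by (auto simp: graph_def)
    qed
    then have \<delta>: "\<delta> t = y" if "(t, y) \<in> \<Union>C" for t y
      unfolding \<delta>_def using that by blast
    have agree: "\<delta> t = \<epsilon> t" if "graph K \<epsilon> \<in> C" "t \<in> K" for K \<epsilon> t
      using \<delta>[of t "\<epsilon> t"] that unfolding graph_def by blast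
    \<comment> \<open>As a union of open intervals that all contain \<open>t0\<close>, the domain is
      open and connected, hence an open interval.\<close>
    have J: "J = \<Union>{K. \<exists>\<epsilon>. graph K \<epsilon> \<in> C \<and> ext K \<epsilon>}" (is "_ = \<Union>?\<K>")
    proof
      show "J \<subseteq> \<Union>?\<K>"
      proof
        fix t assume "t \<in> J"
        then obtain X where "X \<in> C" "t \<in> fst ` X"
          unfolding J_def by blast
        moreover obtain K \<epsilon> where "X = graph K \<epsilon>" "ext K \<epsilon>"
          using member[OF \<open>X \<in> C\<close>] by blast
        ultimately show "t \<in> \<Union>?\<K>"
          using fst_graph by blast
      qed
      show "\<Union>?\<K> \<subseteq> J"
        using fst_graph unfolding J_def by blast
    qed
    have "open J"
      unfolding J by (rule open_Union) (auto simp: ext_def integral_curve_def)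
    moreover have "is_interval J"
      unfolding is_interval_connected_1 J
    proof (rule connected_Union)
      show "connected K" if "K \<in> ?\<K>" for K
        using that by (auto simp: ext_def integral_curve_def is_interval_connected_1)
      show "\<Inter>?\<K> \<noteq> {}"
        using t0 by (auto simp: ext_def)
    qed
    moreover have "I \<subseteq> J \<and> (\<forall>t\<in>I. \<delta> t = \<gamma> t)"
    proof -
      obtain K \<epsilon> where "graph K \<epsilon> \<in> C" "ext K \<epsilon>"
        using C(1) member by blast
      moreover from this have "K \<subseteq> J"
        unfolding J by blast
      ultimately show ?thesis
        using agree[of K \<epsilon>] unfolding ext_def by (metis subset_iff)
    qed
    \<comment> \<open>The equation is local: on the open domain of a chain member around
      \<open>t\<close>, \<open>\<delta>\<close> coincides with that member.\<close>
    moreover have "(\<delta> has_vector_derivative g (\<delta> t)) (at t)" if t: "t \<in> J" for t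
    proof -
      obtain K \<epsilon> where K: "graph K \<epsilon> \<in> C" "ext K \<epsilon>" "t \<in> K"
        using t unfolding J by blast
      then have "(\<epsilon> has_vector_derivative g (\<epsilon> t)) (at t)" "open K"
        by (auto simp: ext_def integral_curve_def)
      then have "(\<delta> has_vector_derivative g (\<epsilon> t)) (at t)"
        by (rule has_vector_derivative_transform_within_open[OF _ _ K(3)])
           (simp add: agree[OF K(1)])
      then show ?thesis
        using agree[OF K(1,3)] by simp
    qed
    ultimately have "ext J \<delta>"
      using t0 by (auto simp: ext_def integral_curve_def)
    moreover have "\<Union>C = graph J \<delta>"
    proof -
      have dom: "t \<in> J \<longleftrightarrow> (\<exists>y. (t, y) \<in> \<Union>C)" for t
        unfolding J_def by (simp add: image_iff Bex_def)
      have "(t, y) \<in> \<Union>C \<longleftrightarrow> t \<in> J \<and> y = \<delta> t" for t y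
        using \<delta> dom by metis
      then have "(t, y) \<in> \<Union>C \<longleftrightarrow> (t, y) \<in> graph J \<delta>" for t y
        by (simp add: graph_def image_iff)
      then show ?thesis
        unfolding set_eq_iff split_paired_All by blast
    qed
    ultimately show "\<Union>C \<in> A"
      unfolding A_def by blast
  qed
  then obtain J \<delta> where J: "ext J \<delta>"
    and max: "\<And>X. X \<in> A \<Longrightarrow> graph J \<delta> \<subseteq> X \<Longrightarrow> X = graph J \<delta>"
    unfolding A_def by auto
  have "maximal_integral_curve g J \<delta>"
    unfolding maximal_integral_curve_def
  proof (intro conjI allI impI)
    \<comment> \<open>A further extension of \<open>\<delta>\<close> still extends
      \<open>\<gamma>\<close>, so its graph competes in \<open>A\<close>. Maximality makes the
      graphs equal, and projecting to the first coordinate gives equal domains.\<close>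
    fix K \<epsilon> assume K: "integral_curve g K \<epsilon> \<and> J \<subseteq> K \<and> (\<forall>t\<in>J. \<epsilon> t = \<delta> t)"
    then have "ext K \<epsilon>"
      using J unfolding ext_def by (metis subset_iff)
    then have "graph K \<epsilon> \<in> A"
      unfolding A_def by blast
    moreover have "graph J \<delta> \<subseteq> graph K \<epsilon>"
      using K by (force simp: graph_def)
    ultimately have "graph K \<epsilon> = graph J \<delta>"
      by (rule max)
    then show "K = J"
      using fst_graph by metis
  qed (use J in \<open>simp add: ext_def\<close>)
  then show ?thesis
    by (rule that) (use J in \<open>auto simp: ext_def\<close>)
qed

subsection \<open>Projection along integral curves and classes modulo a field\<close>

lemma projection_derivative_along_field:
  fixes g :: "'a::euclidean_space vfield"
  assumes "smooth g" "\<pi> differentiable (at x)"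
    and unique: "\<And>I \<gamma>. maximal_integral_curve g I \<gamma> \<Longrightarrow> \<exists>!p. p \<in> \<gamma> ` I \<and> p \<in> S"
    and proj: "\<And>I \<gamma> t. maximal_integral_curve g I \<gamma> \<Longrightarrow> t \<in> I \<Longrightarrow> \<pi> (\<gamma> t) \<in> \<gamma> ` I \<inter> S"
  shows "frechet_derivative \<pi> (at x) (g x) = 0"
proof -
  obtain I0 \<gamma>0 where "integral_curve g I0 \<gamma>0" "0 \<in> I0" "\<gamma>0 0 = x"
    using smooth_integral_curve_exists[OF assms(1)] by blast
  then obtain I \<gamma> where max: "maximal_integral_curve g I \<gamma>" and "0 \<in> I" "\<gamma> 0 = x"
    by (metis integral_curve_extends_maximal subsetD)
  then have I: "open I" "(\<gamma> has_vector_derivative g x) (at 0)"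
    by (auto simp: maximal_integral_curve_def integral_curve_def)
  \<comment> \<open>The derivative is restricted to the range of the curve to fit the chain rule,
    which then computes the velocity of \<open>\<pi> \<circ> \<gamma>\<close> at 0.\<close>
  have "(\<pi> has_derivative frechet_derivative \<pi> (at x)) (at (\<gamma> 0) within range \<gamma>)"
    using assms(2) \<open>\<gamma> 0 = x\<close> frechet_derivative_works has_derivative_at_withinI by blast
  then have "((\<pi> \<circ> \<gamma>) has_vector_derivative frechet_derivative \<pi> (at x) (g x)) (at 0)"
    using vector_derivative_diff_chain_within[OF I(2)] by blast
  \<comment> \<open>Both values lie in the intersection of the curve with \<open>S\<close>, which is
    a single point.\<close>
  moreover have "\<pi> (\<gamma> t) = \<pi> (\<gamma> 0)" if "t \<in> I" for t
    using unique[OF max] proj[OF max that] proj[OF max \<open>0 \<in> I\<close>] by blast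
  then have "((\<pi> \<circ> \<gamma>) has_vector_derivative 0) (at 0)"
    by (intro has_vector_derivative_transform_within_open[OF has_vector_derivative_const I(1) \<open>0 \<in> I\<close>])
       simp
  ultimately show ?thesis
    by (rule vector_derivative_unique_at)
qed

lemma class_mod_self: "m \<in> class_mod g m"
  unfolding class_mod_def by (auto intro!: exI[of _ "\<lambda>x. 0"] simp: smooth_on_const)

lemma class_mod_subset:
  assumes "smooth \<beta>"
  shows "class_mod g (\<lambda>x. m x + \<beta> x *\<^sub>R g x) \<subseteq> class_mod g m"
proof
  fix y assume "y \<in> class_mod g (\<lambda>x. m x + \<beta> x *\<^sub>R g x)"
  then obtain \<alpha> where "smooth \<alpha>" "y = (\<lambda>x. m x + \<beta> x *\<^sub>R g x + \<alpha> x *\<^sub>R g x)"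
    by (auto simp: class_mod_def)
  then show "y \<in> class_mod g m"
    using assms unfolding class_mod_def
    by (auto intro!: exI[of _ "\<lambda>x. \<beta> x + \<alpha> x"] smooth_on_add simp: algebra_simps)
qed

lemma class_mod_shift:
  assumes "smooth \<beta>"
  shows "class_mod g (\<lambda>x. m x + \<beta> x *\<^sub>R g x) = class_mod g m"
proof
  \<comment> \<open>Shifting back by \<open>-\<beta>\<close> turns the reverse inclusion into an
    instance of \<open>class_mod_subset\<close>.\<close>
  have "smooth (\<lambda>x. (-1) * \<beta> x)"
    by (intro smooth_on_bilinear[OF open_UNIV bounded_bilinear_mult] smooth_on_const assms)
  from class_mod_subset[OF this, of g "\<lambda>x. m x + \<beta> x *\<^sub>R g x"]
  show "class_mod g m \<subseteq> class_mod g (\<lambda>x. m x + \<beta> x *\<^sub>R g x)"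
    by simp
qed (rule class_mod_subset[OF assms])

theorem proposition2:
  fixes g :: "(real ^ 'n) vfield"
    and \<omega> :: "(real ^ 'n) one_form"
    and \<psi> \<mu> :: "real ^ 'n \<Rightarrow> real"
    and \<O> :: "(real ^ 'n) set"
    and \<pi> :: "real ^ 'n \<Rightarrow> real ^ 'n"
  assumes "smooth g"
    and "smooth \<omega>"
    and "\<And>x. blinfun_apply (\<omega> x) (g x) \<noteq> 0"
    and "\<And>x u v w. wedge21 (ext_deriv \<omega>) \<omega> x u v w = 0"
    and "smooth \<psi>"
    and "\<And>x. \<mu> x \<noteq> 0"
    and "\<And>x v. frechet_derivative \<psi> (at x) v = \<mu> x * blinfun_apply (\<omega> x) v"
    and "\<O> = {x. \<psi> x = 0}"
    and "\<And>I \<gamma>. maximal_integral_curve g I \<gamma> \<Longrightarrow> \<exists>!p. p \<in> \<gamma> ` I \<and> p \<in> \<O>"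
    and "smooth \<pi>"
    and "\<And>I \<gamma> t. maximal_integral_curve g I \<gamma> \<Longrightarrow> t \<in> I \<Longrightarrow> \<pi> (\<gamma> t) \<in> \<gamma> ` I \<inter> \<O>"
  shows "bij_betw (class_mod g)
           {m. projectable_vector_field \<omega> \<O> \<pi> m}
           (class_mod g ` {m. smooth m \<and> projects_to_vector_field \<O> \<pi> m})"
proof -
  note g = assms(1) and \<omega> = assms(2) and \<omega>g = assms(3)
  have \<pi>: "\<pi> differentiable (at x)" for x
    using smooth_on_has_derivative[OF assms(10)] by (auto simp: differentiable_def)
  have d\<pi>_g: "frechet_derivative \<pi> (at x) (g x) = 0" for x
    by (rule projection_derivative_along_field[OF g \<pi> assms(9,11)])
  have "inj_on (class_mod g) {m. projectable_vector_field \<omega> \<O> \<pi> m}"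
  proof (rule inj_onI, clarify)
    fix m1 m2
    assume m: "projectable_vector_field \<omega> \<O> \<pi> m1" "projectable_vector_field \<omega> \<O> \<pi> m2"
      and "class_mod g m1 = class_mod g m2"
    \<comment> \<open>\<open>m2\<close> belongs to its own class, hence to that of
      \<open>m1\<close>. Applying \<open>\<omega>\<close> to the resulting equation leaves
      \<open>\<alpha>\<close> times the nonzero function \<open>\<omega>(g)\<close>.\<close>
    then obtain \<alpha> where \<alpha>: "m2 = (\<lambda>x. m1 x + \<alpha> x *\<^sub>R g x)"
      using class_mod_self[of m2 g] by (auto simp: class_mod_def)
    have "\<alpha> x = 0" for x
    proof -
      have "\<omega> x (m1 x) = 0" "\<omega> x (m2 x) = 0"
        using m by (auto simp: projectable_vector_field_def)
      then show ?thesis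
        using \<omega>g[of x] by (simp add: \<alpha> blinfun.add_right blinfun.scaleR_right)
    qed
    then show "m1 = m2" by (simp add: \<alpha>)
  qed
  moreover have "class_mod g m \<in> class_mod g ` {m. projectable_vector_field \<omega> \<O> \<pi> m}"
    if m: "smooth m" "projects_to_vector_field \<O> \<pi> m" for m
  proof -
    \<comment> \<open>With this coefficient \<open>m'\<close> below is the anchor image
      \<open>m - (\<omega>(m)/\<omega>(g)) g\<close>. The quotient is spelled with products and
      \<open>inverse\<close> so that smoothness follows from the closure lemmas.\<close>
    define \<beta> where "\<beta> x = (-1) * (\<omega> x (m x) * inverse (\<omega> x (g x)))" for x
    have \<beta>: "smooth \<beta>"
      unfolding \<beta>_def
      by (intro smooth_on_bilinear[OF open_UNIV bounded_bilinear_mult] smooth_on_const smooth_on_inverse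
            smooth_on_bilinear[OF open_UNIV bounded_bilinear_blinfun_apply] open_UNIV \<omega> g m \<omega>g)
    define m' where "m' = (\<lambda>x. m x + \<beta> x *\<^sub>R g x)"
    have "smooth m'"
      unfolding m'_def
      by (intro smooth_on_add smooth_on_bilinear[OF open_UNIV bounded_bilinear_scaleR] open_UNIV \<beta> g m)
    \<comment> \<open>Since \<open>d\<pi>(g) = 0\<close>, the correction is invisible to
      \<open>\<pi>\<close>, and \<open>m'\<close> projects to the same field on \<open>\<O>\<close>
      as \<open>m\<close>.\<close>
    moreover have "frechet_derivative \<pi> (at x) (m' x) = frechet_derivative \<pi> (at x) (m x)" for x
    proof -
      interpret linear "frechet_derivative \<pi> (at x)"
        by (rule linear_frechet_derivative[OF \<pi>])
      show ?thesis by (simp add: m'_def add scale d\<pi>_g)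
    qed
    then have "projects_to_vector_field \<O> \<pi> m'"
      using m(2) by (simp add: projects_to_vector_field_def)
    moreover have "\<omega> x (m' x) = 0" for x
      using \<omega>g[of x] by (simp add: m'_def \<beta>_def blinfun.diff_right blinfun.scaleR_right)
    ultimately have "projectable_vector_field \<omega> \<O> \<pi> m'"
      by (simp add: projectable_vector_field_def)
    moreover have "class_mod g m = class_mod g m'"
      unfolding m'_def by (rule class_mod_shift[OF \<beta>, symmetric])
    ultimately show ?thesis by blast
  qed
  \<comment> \<open>One inclusion holds because every projectable field is smooth and projects; the
    other is the normalisation just proved.\<close>
  then have "class_mod g ` {m. projectable_vector_field \<omega> \<O> \<pi> m} =
      class_mod g ` {m. smooth m \<and> projects_to_vector_field \<O> \<pi> m}"
    by (auto simp: projectable_vector_field_def)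
  ultimately show ?thesis
    by (simp add: bij_betw_def)
qed

end
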